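(* Let $n,d\ge 1$ be integers and $r=\binom{n+d}{n}-1$. Fix $q\in \mathbb{P}^r=\mathbb{P}(\mathbb{C}[z_0,\dots,z_n]_d)$ and take a finite set $S\subset \mathbb{P}^n$ such that $\nu_d(S)$ minimally spans $q$. (a) If $|S|\le \binom{n+\lfloor d/2\rfloor}{n}$ and $S$ gives $|S|$ independent conditions to the complex vector space $\mathbb{C}[z_0,\dots,z_n]_{\lfloor d/2\rfloor}$, then $r_X(q)=|S|$. (b) If $|S|\le \binom{n+\lfloor d/2\rfloor-1}{n}$ and $S$ gives $|S|$ independent conditions to the complex vector space $\mathbb{C}[z_0,\dots,z_n]_{\lfloor d/2\rfloor-1}$, then $S$ is the unique set evincing the rank of $q$.
   Context: $\mathbb{C}[z_0,\dots,z_n]_t$ is the complex vector space of homogeneous polynomials of degree $t$ in $z_0,\dots,z_n$. $\mathbb{P}^n:=\mathbb{P}(\mathbb{C}[z_0,\dots,z_n]_1)$, so a point of $\mathbb{P}^n$ is the class $[\ell]$ of a non-zero linear form $\ell=a_0z_0+\cdots+a_nz_n$ up to a non-zero scalar; it has homogeneous coordinates $[a_0:\dots:a_n]$, and forms in $\mathbb{C}[z_0,\dots,z_n]_t$ are evaluated at it via $(a_0,\dots,a_n)$. $\nu_d:\mathbb{P}^n\to\mathbb{P}^r$ is the order $d$ Veronese embedding $[\ell]\mapsto[\ell^d]$, and $X:=\nu_d(\mathbb{P}^n)$. $\langle\ \rangle$ denotes projective linear span. For a finite set $S\subset\mathbb{P}^n$, $\nu_d(S)$ minimally spans $q$ if $q\in\langle\nu_d(S)\rangle$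 and $q\notin\langle\nu_d(S')\rangle$ for every $S'\subsetneq S$. The rank $r_X(q)$ of $q$ is the minimal cardinality of a finite set $A\subset\mathbb{P}^n$ with $q\in\langle\nu_d(A)\rangle$ (equivalently, if $q=[f]$, the minimal number of summands in an expression $f=\sum\ell_i^d$ with $\ell_i$ linear forms). A finite set $A\subset\mathbb{P}^n$ evinces the rank of $q$ if $q\in\langle\nu_d(A)\rangle$ and $|A|=r_X(q)$. Each $p\in\mathbb{P}^n$ gives a linear condition on $\mathbb{C}[z_0,\dots,z_n]_t$ by evaluating forms at a representative of $p$ in $\mathbb{C}^{n+1}\setminus\{0\}$. A finite set $S$ gives $|S|$ independent conditions to $\mathbb{C}[z_0,\dots,z_n]_t$ if the corresponding $|S|$ evaluation functionals are linearly independent (this does not depend on the representatives). *)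

theory Defs
  imports Complex_Main "HOL-Library.Poly_Mapping"
begin

text \<open>Polynomials over the complex numbers in the variables \<open>z\<^sub>0, z\<^sub>1, \<dots>\<close>; a monomial is its
  finitely supported exponent vector.\<close>

type_synonym cpoly = "(nat \<Rightarrow>\<^sub>0 nat) \<Rightarrow>\<^sub>0 complex"

definition scale :: "complex \<Rightarrow> cpoly \<Rightarrow> cpoly" where
  "scale c f = Poly_Mapping.single 0 c * f"

lemma lookup_scale [simp]:
  "Poly_Mapping.lookup (scale c f) m = c * Poly_Mapping.lookup f m"
  unfolding scale_def mult_map_scale_conv_mult[symmetric] by (simp add: map.rep_eq when_def)

lemma scale_scale: "scale a (scale b f) = scale (a * b) f"
  by (rule poly_mapping_eqI) (simp add: mult.assoc)

lemma scale_power: "scale c f ^ k = scale (c ^ k) (f ^ k)"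
  by (induction k) (simp_all add: scale_def mult_single flip: single_one)

global_interpretation cpoly: vector_space scale
  by unfold_locales
    (auto intro!: poly_mapping_eqI simp: lookup_add algebra_simps)

definition monom_degree :: "(nat \<Rightarrow>\<^sub>0 nat) \<Rightarrow> nat" where
  "monom_degree m = (\<Sum>i\<in>Poly_Mapping.keys m. Poly_Mapping.lookup m i)"

text \<open>The space of homogeneous polynomials of degree \<open>t\<close> in \<open>z\<^sub>0, \<dots>, z\<^sub>n\<close> (including \<open>0\<close>).\<close>

definition forms :: "nat \<Rightarrow> nat \<Rightarrow> cpoly set" where
  "forms n t =
    {f. \<forall>m\<in>Poly_Mapping.keys f. Poly_Mapping.keys m \<subseteq> {0..n} \<and> monom_degree m = t}"

definition eval_form :: "cpoly \<Rightarrow> (nat \<Rightarrow> complex) \<Rightarrow> complex" where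
  "eval_form f a = (\<Sum>m\<in>Poly_Mapping.keys f. Poly_Mapping.lookup f m *
                 (\<Prod>i\<in>Poly_Mapping.keys m. a i ^ Poly_Mapping.lookup m i))"

definition proj_class :: "cpoly \<Rightarrow> cpoly set" where
  "proj_class f = {scale c f | c. c \<noteq> 0}"

definition Proj :: "cpoly set \<Rightarrow> cpoly set set" where
  "Proj V = proj_class ` (V - {0})"

definition proj_span :: "cpoly set set \<Rightarrow> cpoly set set" where
  "proj_span A = Proj (cpoly.span (\<Union>A))"

abbreviation proj_space :: "nat \<Rightarrow> cpoly set set" where
  "proj_space n \<equiv> Proj (forms n 1)"

text \<open>The map \<open>[\<ell>] \<mapsto> [\<ell>\<^sup>d]\<close>; all members of the union coincide, see \<open>veronese_proj_class\<close>.\<close>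

definition veronese :: "nat \<Rightarrow> cpoly set \<Rightarrow> cpoly set" where
  "veronese d p = (\<Union>l\<in>p. proj_class (l ^ d))"

lemma proj_class_scale: "c \<noteq> 0 \<Longrightarrow> proj_class (scale c f) = proj_class f"
  unfolding proj_class_def
  by (auto simp: scale_scale) (metis divide_eq_0_iff nonzero_eq_divide_eq)

lemma veronese_proj_class: "veronese d (proj_class l) = proj_class (l ^ d)"
proof -
  have "proj_class (k ^ d) = proj_class (l ^ d)" if "k \<in> proj_class l" for k
    using that by (auto simp: proj_class_def[of l] scale_power proj_class_scale)
  moreover have "l \<in> proj_class l"
    by (auto simp: proj_class_def intro: exI[of _ 1])
  ultimately show ?thesis
    unfolding veronese_def by blast
qed

definition minimally_spans :: "nat \<Rightarrow> cpoly set set \<Rightarrow> cpoly set \<Rightarrow> bool" where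
  "minimally_spans d S q \<longleftrightarrow>
    q \<in> proj_span (veronese d ` S) \<and> (\<forall>S'. S' \<subset> S \<longrightarrow> q \<notin> proj_span (veronese d ` S'))"

definition veronese_rank :: "nat \<Rightarrow> nat \<Rightarrow> cpoly set \<Rightarrow> nat" where
  "veronese_rank n d q = (LEAST k. \<exists>A. finite A \<and> A \<subseteq> proj_space n \<and>
                   q \<in> proj_span (veronese d ` A) \<and> card A = k)"

definition evinces_rank :: "nat \<Rightarrow> nat \<Rightarrow> cpoly set set \<Rightarrow> cpoly set \<Rightarrow> bool" where
  "evinces_rank n d A q \<longleftrightarrow> finite A \<and> A \<subseteq> proj_space n \<and>
     q \<in> proj_span (veronese d ` A) \<and> card A = veronese_rank n d q"

text \<open>The coordinate vector \<open>(a\<^sub>0, a\<^sub>1, \<dots>)\<close> of a linear form \<open>\<Sum>i. a\<^sub>i z\<^sub>i\<close>.\<close>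

definition coords :: "cpoly \<Rightarrow> nat \<Rightarrow> complex" where
  "coords l i = Poly_Mapping.lookup l (Poly_Mapping.single i 1)"

definition representative :: "cpoly set \<Rightarrow> cpoly" where
  "representative p = (SOME l. l \<in> p)"

text \<open>Linear independence of the evaluation functionals on \<open>forms n t\<close>, as a family indexed by \<open>S\<close>
  (rather than as a set of functionals): two points with the same functional, as happens for
  \<open>t = 0\<close>, make it dependent.\<close>

definition independent_conditions :: "nat \<Rightarrow> nat \<Rightarrow> cpoly set set \<Rightarrow> bool" where
  "independent_conditions n t S \<longleftrightarrow>
    (\<forall>c. (\<forall>f\<in>forms n t. (\<Sum>p\<in>S. c p * eval_form f (coords (representative p))) = 0)
          \<longrightarrow> (\<forall>p\<in>S. c p = 0))"

lemma eval_form_coords_scale: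
  assumes "f \<in> forms n t"
  shows "eval_form f (coords (scale c l)) = c ^ t * eval_form f (coords l)"
proof -
  have "(\<Prod>i\<in>Poly_Mapping.keys m. coords (scale c l) i ^ Poly_Mapping.lookup m i) =
        c ^ t * (\<Prod>i\<in>Poly_Mapping.keys m. coords l i ^ Poly_Mapping.lookup m i)"
    if "m \<in> Poly_Mapping.keys f" for m
  proof -
    have "monom_degree m = t"
      using assms that by (auto simp: forms_def)
    then show ?thesis
      by (auto simp: coords_def monom_degree_def power_mult_distrib prod.distrib power_sum)
  qed
  then show ?thesis
    by (simp add: eval_form_def sum_distrib_left mult.left_commute)
qed

lemma independent_conditions_representatives:
  assumes "S \<subseteq> proj_space n" and r: "\<And>p. p \<in> S \<Longrightarrow> r p \<in> p"
  shows "independent_conditions n t S \<longleftrightarrow>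
    (\<forall>c. (\<forall>f\<in>forms n t. (\<Sum>p\<in>S. c p * eval_form f (coords (r p))) = 0)
          \<longrightarrow> (\<forall>p\<in>S. c p = 0))"
proof -
  have "\<exists>k. k \<noteq> 0 \<and> r p = scale k (representative p)" if "p \<in> S" for p
  proof -
    have "p \<in> proj_space n"
      using assms that by blast
    then obtain l where p: "p = proj_class l"
      by (auto simp: Proj_def)
    have rp: "r p \<in> p"
      using r that by blast
    then have "representative p \<in> p"
      unfolding representative_def by (rule someI)
    then obtain a b where "a \<noteq> 0" "b \<noteq> 0" "representative p = scale a l" "r p = scale b l"
      using rp by (auto simp: p proj_class_def)
    then show ?thesis
      by (intro exI[of _ "b / a"]) (simp add: scale_scale)
  qed
  then obtain k where k: "\<And>p. p \<in> S \<Longrightarrow> k p \<noteq> 0"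
      "\<And>p. p \<in> S \<Longrightarrow> r p = scale (k p) (representative p)"
    by metis
  have sum_r: "(\<Sum>p\<in>S. c p * eval_form f (coords (r p))) =
      (\<Sum>p\<in>S. (c p * k p ^ t) * eval_form f (coords (representative p)))"
    if "f \<in> forms n t" for c f
    using that by (intro sum.cong) (auto simp: k eval_form_coords_scale)
  show ?thesis (is "_ \<longleftrightarrow> ?R")
  proof
    assume L: "independent_conditions n t S"
    show ?R
    proof (intro allI impI)
      fix c assume "\<forall>f\<in>forms n t. (\<Sum>p\<in>S. c p * eval_form f (coords (r p))) = 0"
      then have "\<forall>p\<in>S. c p * k p ^ t = 0"
        using L[unfolded independent_conditions_def, THEN spec, of "\<lambda>p. c p * k p ^ t"]
        by (simp add: sum_r)
      then show "\<forall>p\<in>S. c p = 0"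
        using k by auto
    qed
  next
    assume R: ?R
    show "independent_conditions n t S"
      unfolding independent_conditions_def
    proof (intro allI impI)
      fix c
      assume c: "\<forall>f\<in>forms n t. (\<Sum>p\<in>S. c p * eval_form f (coords (representative p))) = 0"
      have "(\<Sum>p\<in>S. c p / k p ^ t * eval_form f (coords (r p))) = 0" if "f \<in> forms n t" for f
      proof -
        have "(\<Sum>p\<in>S. c p / k p ^ t * eval_form f (coords (r p))) =
            (\<Sum>p\<in>S. c p * eval_form f (coords (representative p)))"
          unfolding sum_r[OF that] using k by (intro sum.cong) auto
        then show ?thesis
          using c that by simp
      qed
      then have "\<forall>p\<in>S. c p / k p ^ t = 0"
        using R[THEN spec, of "\<lambda>p. c p / k p ^ t"] by simp
      then show "\<forall>p\<in>S. c p = 0"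
        using k by auto
    qed
  qed
qed

end

theory Submission
  imports Defs
begin

text \<open>
  Write \<open>q = [f]\<close> with \<open>f = \<Sum>p\<in>S. c\<^sub>p l\<^sub>p\<^sup>d\<close>, where \<open>l\<^sub>p\<close> is a linear form representing \<open>p\<close>; minimality
  of \<open>S\<close> makes every \<open>c\<^sub>p\<close> non-zero. Let \<open>f = \<Sum>a\<in>A. b\<^sub>a l\<^sub>a\<^sup>d\<close> be a second decomposition. The proof is
  the classical catalecticant argument in the language of linear relations among powers.

  In characteristic zero the coefficients of \<open>l\<^sup>e\<close> are the values at \<open>l\<close> of the monomials of degree
  \<open>e\<close>, up to non-zero multinomial factors that do not depend on \<open>l\<close>. Hence linear relations among
  \<open>e\<close>-th powers of linear forms are the same as linear relations among the corresponding
  evaluation functionals on forms of degree \<open>e\<close> (\<open>power_relation_iff_evaluation_relation\<close>). As the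
  product of forms of degrees \<open>t\<close> and \<open>d - t\<close> has degree \<open>d\<close>, any form \<open>g\<close> of degree \<open>t \<le> d\<close> turns the
  equality of the two decompositions into
  \<open>\<Sum>p\<in>S. c\<^sub>p g(p) l\<^sub>p\<^bsup>d-t\<^esup> = \<Sum>a\<in>A. b\<^sub>a g(a) l\<^sub>a\<^bsup>d-t\<^esup>\<close> (\<open>contraction\<close>). If \<open>S\<close> gives independent conditions
  in degree \<open>t\<close>, some \<open>g\<close> is \<open>1\<close> at a chosen \<open>p\<close> and \<open>0\<close> on the rest of \<open>S\<close> (\<open>interpolation\<close>), so that
  each \<open>l\<^sub>p\<^bsup>d-t\<^esup>\<close> lies in the span of the \<open>l\<^sub>a\<^bsup>d-t\<^esup>\<close> with \<open>a \<in> A\<close>.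

  If \<open>2t \<le> d\<close> then \<open>S\<close> also gives independent conditions in degree \<open>d - t \<ge> t\<close>, so the powers
  \<open>l\<^sub>p\<^bsup>d-t\<^esup>\<close> are linearly independent and \<open>|S| \<le> |A|\<close>; this is the rank statement, with \<open>t = d div 2\<close>.

  If \<open>2t < d\<close> and \<open>|A| = |S|\<close>, the two spans of \<open>(d-t)\<close>-th powers coincide for dimension reasons. But
  \<open>S\<close> gives independent conditions already in degree \<open>d - t - 1 \<ge> t\<close>, and therefore \<open>S\<close> together with
  any further point \<open>a\<close> does so in degree \<open>d - t\<close> (\<open>independent_conditions_Suc_insert\<close>): then
  \<open>l\<^sub>a\<^bsup>d-t\<^esup>\<close> is outside the span for \<open>S\<close>. So \<open>A\<close> has no point outside \<open>S\<close>, and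
  \<open>A = S\<close>; this is the uniqueness statement, with \<open>t = d div 2 - 1\<close>.
\<close>

section \<open>Evaluation of polynomials and the multinomial theorem\<close>

definition monom_eval :: "(nat \<Rightarrow>\<^sub>0 nat) \<Rightarrow> (nat \<Rightarrow> complex) \<Rightarrow> complex" where
  "monom_eval m a = (\<Prod>i\<in>Poly_Mapping.keys m. a i ^ Poly_Mapping.lookup m i)"

lemma monom_eval_superset:
  "finite I \<Longrightarrow> Poly_Mapping.keys m \<subseteq> I \<Longrightarrow>
    monom_eval m a = (\<Prod>i\<in>I. a i ^ Poly_Mapping.lookup m i)"
  unfolding monom_eval_def by (rule prod.mono_neutral_left) (auto simp: in_keys_iff)

lemma monom_eval_add: "monom_eval (k + m) a = monom_eval k a * monom_eval m a"
proof -
  let ?I = "Poly_Mapping.keys k \<union> Poly_Mapping.keys m"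
  have "Poly_Mapping.keys (k + m) \<subseteq> ?I"
    by (rule keys_add)
  then show ?thesis
    by (simp add: monom_eval_superset[of ?I] lookup_add power_add prod.distrib)
qed

lemma monom_degree_superset:
  "finite I \<Longrightarrow> Poly_Mapping.keys m \<subseteq> I \<Longrightarrow> monom_degree m = (\<Sum>i\<in>I. Poly_Mapping.lookup m i)"
  unfolding monom_degree_def by (rule sum.mono_neutral_left) (auto simp: in_keys_iff)

lemma monom_degree_add: "monom_degree (k + m) = monom_degree k + monom_degree m"
proof -
  let ?I = "Poly_Mapping.keys k \<union> Poly_Mapping.keys m"
  have "Poly_Mapping.keys (k + m) \<subseteq> ?I"
    by (rule keys_add)
  then show ?thesis
    by (simp add: monom_degree_superset[of ?I] lookup_add sum.distrib)
qed

lemma eval_form_superset: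
  "finite M \<Longrightarrow> Poly_Mapping.keys f \<subseteq> M \<Longrightarrow>
    eval_form f a = (\<Sum>m\<in>M. Poly_Mapping.lookup f m * monom_eval m a)"
  unfolding eval_form_def monom_eval_def
  by (rule sum.mono_neutral_left) (auto simp: in_keys_iff)

lemma eval_form_add: "eval_form (f + g) a = eval_form f a + eval_form g a"
proof -
  let ?I = "Poly_Mapping.keys f \<union> Poly_Mapping.keys g"
  have "Poly_Mapping.keys (f + g) \<subseteq> ?I"
    by (rule keys_add)
  then show ?thesis
    by (simp add: eval_form_superset[of ?I] lookup_add sum.distrib algebra_simps)
qed

lemma eval_form_single: "eval_form (Poly_Mapping.single m c) a = c * monom_eval m a"
  using eval_form_superset[of "{m}" "Poly_Mapping.single m c" a] by (cases "c = 0") auto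

lemma eval_form_0 [simp]: "eval_form 0 a = 0"
  by (simp add: eval_form_def)

lemma eval_form_sum: "eval_form (\<Sum>i\<in>I. f i) a = (\<Sum>i\<in>I. eval_form (f i) a)"
  by (induction I rule: infinite_finite_induct) (auto simp: eval_form_add)

lemma sum_single_lookup:
  assumes "finite M" "Poly_Mapping.keys f \<subseteq> M"
  shows "f = (\<Sum>m\<in>M. Poly_Mapping.single m (Poly_Mapping.lookup f m))"
proof (rule poly_mapping_eqI)
  fix k
  show "Poly_Mapping.lookup f k =
      Poly_Mapping.lookup (\<Sum>m\<in>M. Poly_Mapping.single m (Poly_Mapping.lookup f m)) k"
    using assms by (auto simp: lookup_sum lookup_single when_def in_keys_iff)
qed

lemma eval_form_mult: "eval_form (f * g) a = eval_form f a * eval_form g a"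
proof -
  have fg: "f * g = (\<Sum>k\<in>Poly_Mapping.keys f. \<Sum>m\<in>Poly_Mapping.keys g.
      Poly_Mapping.single (k + m) (Poly_Mapping.lookup f k * Poly_Mapping.lookup g m))"
    by (subst sum_single_lookup[of "Poly_Mapping.keys f" f], simp, simp,
        subst sum_single_lookup[of "Poly_Mapping.keys g" g], simp, simp)
      (simp add: sum_product mult_single)
  show ?thesis
    unfolding fg eval_form_sum eval_form_single
    by (simp add: eval_form_superset[of "Poly_Mapping.keys f" f]
        eval_form_superset[of "Poly_Mapping.keys g" g] sum_product monom_eval_add mult_ac)
qed

lemma eval_form_scale: "eval_form (scale c f) a = c * eval_form f a"
  by (simp add: scale_def eval_form_mult eval_form_single monom_eval_def)

lemma eval_form_power: "eval_form (f ^ k) a = eval_form f a ^ k"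
  by (induction k) (simp_all add: eval_form_mult eval_form_single monom_eval_def flip: single_one)

lemma eval_form_uminus: "eval_form (- f) a = - eval_form f a"
  using eval_form_add[of f "- f" a] by (simp add: eq_neg_iff_add_eq_0 add.commute)

lemma eval_form_diff: "eval_form (f - g) a = eval_form f a - eval_form g a"
  using eval_form_add[of f "- g" a] by (simp add: eval_form_uminus)

lemma forms_mult:
  assumes "f \<in> forms n s" "g \<in> forms n t"
  shows "f * g \<in> forms n (s + t)"
  unfolding forms_def
proof (intro CollectI ballI)
  fix m assume "m \<in> Poly_Mapping.keys (f * g)"
  then obtain k k' where m: "m = k + k'" "k \<in> Poly_Mapping.keys f" "k' \<in> Poly_Mapping.keys g"
    using keys_mult[of f g] by auto
  then have "Poly_Mapping.keys k \<subseteq> {0..n}" "monom_degree k = s"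
    "Poly_Mapping.keys k' \<subseteq> {0..n}" "monom_degree k' = t"
    using assms by (simp_all add: forms_def)
  then show "Poly_Mapping.keys m \<subseteq> {0..n} \<and> monom_degree m = s + t"
    using keys_add[of k k'] m(1) by (auto simp: monom_degree_add)
qed

lemma subspace_forms: "cpoly.subspace (forms n t)"
proof (rule cpoly.subspaceI)
  show "0 \<in> forms n t"
    by (simp add: forms_def)
  show "f + g \<in> forms n t" if "f \<in> forms n t" "g \<in> forms n t" for f g
    using that keys_add[of f g] by (auto simp: forms_def)
  show "scale c f \<in> forms n t" if "f \<in> forms n t" for c f
    using that by (auto simp: forms_def in_keys_iff)
qed

lemma forms_power: "l \<in> forms n 1 \<Longrightarrow> l ^ e \<in> forms n e"
proof (induction e)
  case 0
  then show ?case
    by (simp add: forms_def monom_degree_def)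
next
  case (Suc e)
  then show ?case
    using forms_mult[of l n 1 "l ^ e" e] by simp
qed

lemma monom_degree_1_iff: "monom_degree m = 1 \<longleftrightarrow> (\<exists>i. m = Poly_Mapping.single i 1)"
proof
  assume 1: "monom_degree m = 1"
  then obtain i where i: "i \<in> Poly_Mapping.keys m"
    by (force simp: monom_degree_def)
  have "Poly_Mapping.lookup m i + (\<Sum>j\<in>Poly_Mapping.keys m - {i}. Poly_Mapping.lookup m j) = 1"
    using 1 i by (simp add: monom_degree_def sum.remove)
  moreover have "Poly_Mapping.lookup m i \<noteq> 0"
    using i by (simp add: in_keys_iff)
  ultimately have "Poly_Mapping.lookup m i = 1"
    "(\<Sum>j\<in>Poly_Mapping.keys m - {i}. Poly_Mapping.lookup m j) = 0"
    by linarith+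
  then have "m = Poly_Mapping.single i 1"
    by (intro poly_mapping_eqI) (auto simp: lookup_single when_def in_keys_iff)
  then show "\<exists>i. m = Poly_Mapping.single i 1" ..
qed (auto simp: monom_degree_def)

lemma linear_form_eq_sum:
  assumes "l \<in> forms n 1" "finite I" "{0..n} \<subseteq> I"
  shows "l = (\<Sum>i\<in>I. Poly_Mapping.single (Poly_Mapping.single i 1) (coords l i))"
proof -
  have "Poly_Mapping.keys l \<subseteq> (\<lambda>i. Poly_Mapping.single i 1) ` I"
  proof
    fix m assume "m \<in> Poly_Mapping.keys l"
    then have "Poly_Mapping.keys m \<subseteq> I" "monom_degree m = 1"
      using assms by (auto simp: forms_def)
    moreover from this(2) obtain i where "m = Poly_Mapping.single i 1"
      using monom_degree_1_iff by blast
    ultimately show "m \<in> (\<lambda>i. Poly_Mapping.single i 1) ` I"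
      by simp
  qed
  moreover have "inj_on (\<lambda>i. Poly_Mapping.single i (1::nat)) I"
    by (rule inj_onI) (metis lookup_single_eq lookup_single_not_eq one_neq_zero)
  ultimately show ?thesis
    using assms(2) sum_single_lookup[of "(\<lambda>i. Poly_Mapping.single i 1) ` I" l]
    by (simp add: sum.reindex coords_def)
qed

lemma lookup_single_mult_add:
  fixes g :: cpoly
  shows "Poly_Mapping.lookup (Poly_Mapping.single k c * g) (k + m) = c * Poly_Mapping.lookup g m"
  by (simp add: lookup_mult lookup_single when_mult)

lemma lookup_single_mult_eq_0:
  fixes g :: cpoly
  assumes "\<And>m'. m \<noteq> k + m'"
  shows "Poly_Mapping.lookup (Poly_Mapping.single k c * g) m = 0"
  by (simp add: lookup_mult lookup_single when_mult assms)

definition monom_fact :: "(nat \<Rightarrow>\<^sub>0 nat) \<Rightarrow> complex" where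
  "monom_fact m = (\<Prod>i\<in>Poly_Mapping.keys m. fact (Poly_Mapping.lookup m i))"

lemma monom_fact_superset:
  "finite I \<Longrightarrow> Poly_Mapping.keys m \<subseteq> I \<Longrightarrow>
    monom_fact m = (\<Prod>i\<in>I. fact (Poly_Mapping.lookup m i))"
  unfolding monom_fact_def by (rule prod.mono_neutral_left) (auto simp: in_keys_iff)

lemma monom_fact_nonzero: "monom_fact m \<noteq> 0"
  by (simp add: monom_fact_def)

lemma monom_fact_add_single:
  "monom_fact (Poly_Mapping.single i 1 + m) =
    of_nat (Suc (Poly_Mapping.lookup m i)) * monom_fact m"
proof -
  let ?I = "insert i (Poly_Mapping.keys m)"
  have sub: "Poly_Mapping.keys (Poly_Mapping.single i 1 + m) \<subseteq> ?I"
    using keys_add[of "Poly_Mapping.single i 1" m] by auto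
  have "monom_fact (Poly_Mapping.single i 1 + m) =
      (\<Prod>j\<in>?I. fact (Poly_Mapping.lookup (Poly_Mapping.single i 1 + m) j))"
    using sub by (intro monom_fact_superset) auto
  also have "\<dots> = fact (Suc (Poly_Mapping.lookup m i)) *
      (\<Prod>j\<in>?I - {i}. fact (Poly_Mapping.lookup m j))"
    by (subst prod.remove[of _ i])
      (auto simp: lookup_add lookup_single when_def intro!: prod.cong)
  also have "\<dots> = of_nat (Suc (Poly_Mapping.lookup m i)) *
      (\<Prod>j\<in>?I. fact (Poly_Mapping.lookup m j))"
    by (subst prod.remove[of ?I i]) (auto simp: mult_ac)
  also have "(\<Prod>j\<in>?I. fact (Poly_Mapping.lookup m j)) = monom_fact m"
    by (intro monom_fact_superset[symmetric]) auto
  finally show ?thesis .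
qed

lemma split_off_variable:
  assumes "i \<in> Poly_Mapping.keys m"
  shows "m = Poly_Mapping.single i 1 + (m - Poly_Mapping.single i (1::nat))"
proof (rule poly_mapping_eqI)
  fix j
  have "Poly_Mapping.lookup m i \<noteq> 0"
    using assms by (simp add: in_keys_iff)
  then show "Poly_Mapping.lookup m j =
      Poly_Mapping.lookup (Poly_Mapping.single i 1 + (m - Poly_Mapping.single i 1)) j"
    by (auto simp: lookup_add lookup_minus lookup_single when_def)
qed

text \<open>The coefficient of a monomial in a power of a linear form, with the multinomial coefficient
  cleared of denominators. Peeling off one factor \<open>l = \<Sum>i. a\<^sub>i z\<^sub>i\<close> reduces \<open>m\<close> to \<open>m / z\<^sub>i\<close> for each
  variable in \<open>m\<close>; the factors \<open>m\<^sub>i\<close> gained from the factorials sum to the degree of \<open>m\<close>.\<close>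

lemma multinomial_theorem:
  assumes l: "l \<in> forms n 1" and "monom_degree m = e"
  shows "Poly_Mapping.lookup (l ^ e) m * monom_fact m = fact e * monom_eval m (coords l)"
  using assms(2)
proof (induction e arbitrary: m)
  case 0
  then have "m = 0"
    by (intro poly_mapping_eqI) (auto simp: monom_degree_def in_keys_iff)
  then show ?case
    by (simp add: monom_fact_def monom_eval_def)
next
  case (Suc e)
  let ?K = "Poly_Mapping.keys m"
  let ?I = "{0..n} \<union> ?K"
  let ?z = "\<lambda>i. Poly_Mapping.single (Poly_Mapping.single i 1) (coords l i)"
  have term_zero: "Poly_Mapping.lookup (?z i * l ^ e) m = 0" if "i \<notin> ?K" for i
  proof (rule lookup_single_mult_eq_0)
    fix m'
    have "Poly_Mapping.lookup m i = 0"
      using that by (simp add: in_keys_iff)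
    then show "m \<noteq> Poly_Mapping.single i 1 + m'"
      by (auto simp: lookup_add)
  qed
  have term_nonzero: "Poly_Mapping.lookup (?z i * l ^ e) m * monom_fact m =
      of_nat (Poly_Mapping.lookup m i) * (fact e * monom_eval m (coords l))" if "i \<in> ?K" for i
  proof -
    define m' where "m' = m - Poly_Mapping.single i 1"
    have m: "m = Poly_Mapping.single i 1 + m'"
      unfolding m'_def by (rule split_off_variable[OF that])
    have "monom_degree m' = e"
      using Suc.prems monom_degree_add[of "Poly_Mapping.single i 1" m']
      by (simp add: m monom_degree_def)
    then have IH: "Poly_Mapping.lookup (l ^ e) m' * monom_fact m' =
        fact e * monom_eval m' (coords l)"
      by (rule Suc.IH)
    have "Poly_Mapping.lookup (?z i * l ^ e) m * monom_fact m =
        of_nat (Suc (Poly_Mapping.lookup m' i)) * coords l i *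
          (Poly_Mapping.lookup (l ^ e) m' * monom_fact m')"
      unfolding m lookup_single_mult_add monom_fact_add_single by (simp only: mult_ac)
    also have "\<dots> = of_nat (Poly_Mapping.lookup m i) * (fact e * monom_eval m (coords l))"
      unfolding IH by (simp add: m lookup_add monom_eval_add)
        (simp add: monom_eval_def)
    finally show ?thesis .
  qed
  have "l ^ Suc e = (\<Sum>i\<in>?I. ?z i * l ^ e)"
    unfolding power_Suc sum_distrib_right[symmetric]
    by (rule arg_cong[where f = "\<lambda>x. x * l ^ e"], rule linear_form_eq_sum[OF l]) auto
  then have "Poly_Mapping.lookup (l ^ Suc e) m * monom_fact m =
      (\<Sum>i\<in>?I. Poly_Mapping.lookup (?z i * l ^ e) m * monom_fact m)"
    by (simp add: lookup_sum sum_distrib_right)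
  also have "\<dots> = (\<Sum>i\<in>?K. Poly_Mapping.lookup (?z i * l ^ e) m * monom_fact m)"
    by (rule sum.mono_neutral_right) (auto simp: term_zero[simplified])
  also have "\<dots> = (\<Sum>i\<in>?K. of_nat (Poly_Mapping.lookup m i)) * (fact e * monom_eval m (coords l))"
    by (simp add: term_nonzero[simplified] sum_distrib_right)
  also have "(\<Sum>i\<in>?K. of_nat (Poly_Mapping.lookup m i)) = (of_nat (Suc e) :: complex)"
    using Suc.prems by (simp add: monom_degree_def flip: of_nat_sum)
  finally show ?case
    by (simp add: mult_ac)
qed

section \<open>Duality between powers of linear forms and evaluation functionals\<close>

text \<open>By the multinomial theorem the coefficient of \<open>m\<close> in a combination of powers is a fixed non-zero
  multiple of the same combination of values of \<open>m\<close>, and the monomials of degree \<open>e\<close> span the forms.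
  Having a sum on each side lets one statement serve both to compare two decompositions and, with
  \<open>A = {}\<close>, to transfer linear independence.\<close>

lemma power_relation_iff_evaluation_relation:
  assumes l: "l ` (S \<union> A) \<subseteq> forms n 1"
  shows "(\<Sum>p\<in>S. scale (c p) (l p ^ e)) = (\<Sum>p\<in>A. scale (b p) (l p ^ e)) \<longleftrightarrow>
    (\<forall>h\<in>forms n e. (\<Sum>p\<in>S. c p * eval_form h (coords (l p))) =
                   (\<Sum>p\<in>A. b p * eval_form h (coords (l p))))"
    (is "?L \<longleftrightarrow> ?R")
proof -
  let ?ev = "\<lambda>m p. monom_eval m (coords (l p))"
  have lookup: "Poly_Mapping.lookup (l p ^ e) m = fact e / monom_fact m * ?ev m p"
    if "p \<in> S \<union> A" "monom_degree m = e" for p m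
    using multinomial_theorem[of "l p" n m e] l that monom_fact_nonzero[of m]
    by (auto simp: field_simps image_subset_iff)
  have sums: "Poly_Mapping.lookup (\<Sum>p\<in>B. scale (c p) (l p ^ e)) m =
      fact e / monom_fact m * (\<Sum>p\<in>B. c p * ?ev m p)"
    if "B \<subseteq> S \<union> A" "monom_degree m = e" for B m c
    using that lookup
    by (auto simp: lookup_sum sum_distrib_left mult_ac intro!: sum.cong)
  show ?thesis
  proof
    assume ?L
    then have mono: "(\<Sum>p\<in>S. c p * ?ev m p) = (\<Sum>p\<in>A. b p * ?ev m p)"
      if "monom_degree m = e" for m
      using sums[of S m c] sums[of A m b] that monom_fact_nonzero[of m] by simp
    show ?R
    proof
      fix h assume h: "h \<in> forms n e"
      have *: "(\<Sum>p\<in>B. c p * eval_form h (coords (l p))) =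
          (\<Sum>m\<in>Poly_Mapping.keys h. Poly_Mapping.lookup h m * (\<Sum>p\<in>B. c p * ?ev m p))" for B c
        unfolding eval_form_superset[OF finite_keys order.refl] sum_distrib_left
        by (subst sum.swap) (simp add: mult_ac)
      show "(\<Sum>p\<in>S. c p * eval_form h (coords (l p))) =
          (\<Sum>p\<in>A. b p * eval_form h (coords (l p)))"
        unfolding * using h by (intro sum.cong refl) (auto simp: forms_def mono)
    qed
  next
    assume R: ?R
    show ?L
    proof (rule poly_mapping_eqI)
      fix m
      show "Poly_Mapping.lookup (\<Sum>p\<in>S. scale (c p) (l p ^ e)) m =
          Poly_Mapping.lookup (\<Sum>p\<in>A. scale (b p) (l p ^ e)) m"
      proof (cases "Poly_Mapping.single m 1 \<in> forms n e")
        case True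
        then have "monom_degree m = e"
          by (simp add: forms_def)
        then show ?thesis
          using R[rule_format, OF True] by (simp add: sums eval_form_single)
      next
        case False
        then have "Poly_Mapping.lookup f m = 0" if "f \<in> forms n e" for f
          using that by (auto simp: forms_def in_keys_iff)
        then have "Poly_Mapping.lookup (l p ^ e) m = 0" if "p \<in> S \<union> A" for p
          using that forms_power[of "l p" n e] l by blast
        then show ?thesis
          by (simp add: lookup_sum)
      qed
    qed
  qed
qed

text \<open>Up to a scalar this is the derivative of the common value of the two sums along the differential
  operator \<open>g(\<partial>)\<close>; on the dual side it is only multiplication of test forms by \<open>g\<close>.\<close>

lemma contraction:
  assumes l: "l ` (S \<union> A) \<subseteq> forms n 1"
    and eq: "(\<Sum>p\<in>S. scale (c p) (l p ^ d)) = (\<Sum>p\<in>A. scale (b p) (l p ^ d))"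
    and g: "g \<in> forms n t" and "t \<le> d"
  shows "(\<Sum>p\<in>S. scale (c p * eval_form g (coords (l p))) (l p ^ (d - t))) =
         (\<Sum>p\<in>A. scale (b p * eval_form g (coords (l p))) (l p ^ (d - t)))"
  unfolding power_relation_iff_evaluation_relation[OF l]
proof
  fix h assume "h \<in> forms n (d - t)"
  then have "g * h \<in> forms n d"
    using forms_mult[OF g] \<open>t \<le> d\<close> by fastforce
  then show "(\<Sum>p\<in>S. c p * eval_form g (coords (l p)) * eval_form h (coords (l p))) =
      (\<Sum>p\<in>A. b p * eval_form g (coords (l p)) * eval_form h (coords (l p)))"
    using eq[unfolded power_relation_iff_evaluation_relation[OF l], rule_format, of "g * h"]
    by (simp add: eval_form_mult mult.assoc)
qed

text \<open>A finite linearly independent family of functionals has a dual family. In the induction step, a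
  form witnessing that evaluation at \<open>q\<close> is not a combination of the evaluations on \<open>S\<close> is
  corrected by the dual family of \<open>S\<close> so as to vanish on \<open>S\<close>; rescaled, it is the member dual to \<open>q\<close>,
  and it serves to make the old members vanish at \<open>q\<close>.\<close>

lemma interpolation:
  assumes "finite S"
    and "\<And>c. \<forall>f\<in>forms n t. (\<Sum>p\<in>S. c p * eval_form f (x p)) = 0 \<Longrightarrow> \<forall>p\<in>S. c p = 0"
  shows "\<exists>g. \<forall>p\<in>S. g p \<in> forms n t \<and> (\<forall>p'\<in>S. eval_form (g p) (x p') = of_bool (p' = p))"
  using assms
proof (induction S rule: finite_induct)
  case empty
  then show ?case
    by simp
next
  case (insert q S)
  have "\<forall>p\<in>S. c p = 0" if "\<forall>f\<in>forms n t. (\<Sum>p\<in>S. c p * eval_form f (x p)) = 0" for c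
  proof -
    have "(\<Sum>p\<in>insert q S. (c(q := 0)) p * eval_form f (x p)) =
        (\<Sum>p\<in>S. c p * eval_form f (x p))" for f
      using insert.hyps by (auto intro!: sum.cong)
    then have "\<forall>p\<in>insert q S. (c(q := 0)) p = 0"
      using that by (intro insert.prems) simp
    then show ?thesis
      using insert.hyps by (auto split: if_splits)
  qed
  from insert.IH[OF this] obtain g where g: "\<And>p. p \<in> S \<Longrightarrow> g p \<in> forms n t"
      "\<And>p p'. p \<in> S \<Longrightarrow> p' \<in> S \<Longrightarrow> eval_form (g p) (x p') = of_bool (p' = p)"
    by blast
  (* With these coefficients, the sum of c p * f(p) over insert q S is the value at q of f minus its
     interpolant on S. *)
  define c where "c = (\<lambda>p. - eval_form (g p) (x q))(q := 1)"
  have c_q: "c q = 1" and c_S: "\<And>p. p \<in> S \<Longrightarrow> c p = - eval_form (g p) (x q)"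
    using insert.hyps by (auto simp: c_def)
  then have "\<not> (\<forall>p\<in>insert q S. c p = 0)"
    by simp
  then obtain f where f: "f \<in> forms n t" "(\<Sum>p\<in>insert q S. c p * eval_form f (x p)) \<noteq> 0"
    using insert.prems by blast
  define f' where "f' = f + (\<Sum>p\<in>S. scale (- eval_form f (x p)) (g p))"
  have f': "f' \<in> forms n t"
    unfolding f'_def using f g
    by (intro cpoly.subspace_add cpoly.subspace_sum cpoly.subspace_scale subspace_forms)
  have f'_S: "eval_form f' (x p) = 0" if "p \<in> S" for p
  proof -
    have "(\<Sum>p'\<in>S. eval_form f (x p') * eval_form (g p') (x p)) =
        (\<Sum>p'\<in>S. if p = p' then eval_form f (x p') else 0)"
      using g that by (intro sum.cong) auto
    then show ?thesis
      using that insert.hyps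
      by (simp add: f'_def eval_form_diff eval_form_add eval_form_sum eval_form_scale sum_negf)
  qed
  have "eval_form f' (x q) = (\<Sum>p\<in>insert q S. c p * eval_form f (x p))"
    using insert.hyps
    by (simp add: f'_def c_S c_q eval_form_diff eval_form_sum eval_form_scale sum_negf mult.commute)
  then have f'_q: "eval_form f' (x q) \<noteq> 0"
    using f by simp
  define h where "h = scale (1 / eval_form f' (x q)) f'"
  have h: "h \<in> forms n t" "eval_form h (x q) = 1" "\<And>p. p \<in> S \<Longrightarrow> eval_form h (x p) = 0"
    using f' f'_q f'_S
    by (auto simp: h_def eval_form_scale intro: cpoly.subspace_scale subspace_forms)
  define G where "G = (\<lambda>p. g p + scale (- eval_form (g p) (x q)) h)(q := h)"
  have "G p \<in> forms n t \<and> (\<forall>p'\<in>insert q S. eval_form (G p) (x p') = of_bool (p' = p))"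
    if "p \<in> insert q S" for p
  proof (cases "p = q")
    case True
    then show ?thesis
      using h insert.hyps by (auto simp: G_def)
  next
    case False
    then have "G p \<in> forms n t"
      using that g h unfolding G_def
      by (auto intro!: cpoly.subspace_diff cpoly.subspace_scale subspace_forms)
    then show ?thesis
      using that False g h insert.hyps by (auto simp: G_def eval_form_add eval_form_diff eval_form_scale)
  qed
  then show ?case
    by blast
qed

section \<open>Points of projective space and their spans\<close>

lemma self_in_proj_class: "f \<in> proj_class f"
  by (auto simp: proj_class_def intro: exI[of _ 1])

lemma representative_props:
  assumes "p \<in> proj_space n"
  shows "representative p \<in> forms n 1" "representative p \<noteq> 0" "proj_class (representative p) = p"
proof -
  obtain l where l: "l \<in> forms n 1" "l \<noteq> 0" "p = proj_class l"
    using assms by (auto simp: Proj_def)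
  have "representative p \<in> p"
    unfolding representative_def using self_in_proj_class[of l] l(3)
    by (intro someI[of "\<lambda>x. x \<in> p" l]) simp
  then obtain c where c: "c \<noteq> 0" "representative p = scale c l"
    using l by (auto simp: proj_class_def)
  then show "representative p \<in> forms n 1" "representative p \<noteq> 0"
    "proj_class (representative p) = p"
    using l by (auto simp: proj_class_scale intro: cpoly.subspace_scale subspace_forms)
qed

lemma representatives_in_forms: "S \<subseteq> proj_space n \<Longrightarrow> representative ` S \<subseteq> forms n 1"
  by (rule image_subsetI, rule representative_props(1), rule subsetD)

lemma proj_class_in_Proj_iff:
  assumes "cpoly.subspace V"
  shows "proj_class f \<in> Proj V \<longleftrightarrow> f \<noteq> 0 \<and> f \<in> V"
proof
  assume "proj_class f \<in> Proj V"
  then obtain g where g: "g \<in> V" "g \<noteq> 0" "proj_class f = proj_class g"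
    by (auto simp: Proj_def)
  then obtain c where "c \<noteq> 0" "f = scale c g"
    using self_in_proj_class[of f] by (auto simp: proj_class_def)
  then show "f \<noteq> 0 \<and> f \<in> V"
    using g assms by (auto intro: cpoly.subspace_scale)
qed (auto simp: Proj_def)

lemma span_image_eq_combinations:
  assumes "finite A"
  shows "f \<in> cpoly.span (v ` A) \<longleftrightarrow> (\<exists>c. f = (\<Sum>p\<in>A. scale (c p) (v p)))"
proof
  show "f \<in> cpoly.span (v ` A)" if "\<exists>c. f = (\<Sum>p\<in>A. scale (c p) (v p))"
    using that by (auto intro!: cpoly.span_sum cpoly.span_scale intro: cpoly.span_base)
  show "\<exists>c. f = (\<Sum>p\<in>A. scale (c p) (v p))" if "f \<in> cpoly.span (v ` A)"
    using assms that
  proof (induction A arbitrary: f rule: finite_induct)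
    case empty
    then show ?case
      by simp
  next
    case (insert q A)
    then obtain k where "f - scale k (v q) \<in> cpoly.span (v ` A)"
      by (auto simp: cpoly.span_breakdown_eq)
    with insert.IH obtain c where "f - scale k (v q) = (\<Sum>p\<in>A. scale (c p) (v p))"
      by blast
    then have "f = scale k (v q) + (\<Sum>p\<in>A. scale (c p) (v p))"
      by (simp add: algebra_simps)
    also have "\<dots> = (\<Sum>p\<in>insert q A. scale ((c(q := k)) p) (v p))"
      using insert.hyps by (auto intro!: sum.cong)
    finally show ?case
      by blast
  qed
qed

text \<open>The passage from projective spans to explicit decompositions into powers of the chosen
  representatives.\<close>

lemma in_proj_span_veronese_iff:
  assumes "finite A" "A \<subseteq> proj_space n"
  shows "proj_class f \<in> proj_span (veronese d ` A) \<longleftrightarrow>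
    f \<noteq> 0 \<and> (\<exists>c. f = (\<Sum>p\<in>A. scale (c p) (representative p ^ d)))"
proof -
  let ?v = "\<lambda>p. representative p ^ d"
  have "veronese d p = proj_class (?v p)" if "p \<in> A" for p
    using veronese_proj_class[of d "representative p"] representative_props(3)[of p n] assms that
    by auto
  then have U: "\<Union>(veronese d ` A) = (\<Union>p\<in>A. proj_class (?v p))"
    by simp
  have "cpoly.span (\<Union>(veronese d ` A)) = cpoly.span (?v ` A)"
    unfolding U cpoly.span_eq
  proof (intro conjI subsetI)
    fix x assume "x \<in> (\<Union>p\<in>A. proj_class (?v p))"
    then obtain p c where "p \<in> A" "x = scale c (?v p)"
      by (auto simp: proj_class_def)
    then show "x \<in> cpoly.span (?v ` A)"
      by (auto intro: cpoly.span_scale cpoly.span_base)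
  next
    fix x assume "x \<in> ?v ` A"
    then have "x \<in> (\<Union>p\<in>A. proj_class (?v p))"
      using self_in_proj_class by blast
    then show "x \<in> cpoly.span (\<Union>p\<in>A. proj_class (?v p))"
      by (rule cpoly.span_base)
  qed
  then show ?thesis
    unfolding proj_span_def
    by (simp add: proj_class_in_Proj_iff cpoly.subspace_span span_image_eq_combinations[OF assms(1)])
qed

text \<open>Distinct points have non-proportional coordinate vectors, so some two-by-two minor is non-zero.
  Equivalently, the linear form \<open>a\<^sub>i z\<^sub>j - a\<^sub>j z\<^sub>i\<close> vanishes at \<open>a\<close> but not at \<open>p\<close>.\<close>

lemma distinct_points_separated:
  assumes "p \<in> proj_space n" "a \<in> proj_space n" "p \<noteq> a"
  obtains i j where "coords (representative a) i * coords (representative p) j \<noteq>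
    coords (representative a) j * coords (representative p) i"
proof (rule ccontr)
  let ?P = "representative p" and ?A = "representative a"
  assume "\<not> thesis"
  with that have eq: "coords ?A i * coords ?P j = coords ?A j * coords ?P i" for i j
    by blast
  note P = representative_props[OF assms(1)] and A = representative_props[OF assms(2)]
  have coords_eqI: "f = g" if "f \<in> forms n 1" "g \<in> forms n 1" "\<And>i. coords f i = coords g i" for f g
    using linear_form_eq_sum[of f n "{0..n}"] linear_form_eq_sum[of g n "{0..n}"] that by simp
  have "\<exists>i. coords ?A i \<noteq> 0"
    using coords_eqI[OF A(1) cpoly.subspace_0[OF subspace_forms]] A(2) by (auto simp: coords_def)
  then obtain i where i: "coords ?A i \<noteq> 0"
    by blast
  define k where "k = coords ?P i / coords ?A i"
  have "?P = scale k ?A"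
  proof (rule coords_eqI)
    show "coords ?P j = coords (scale k ?A) j" for j
      using eq[of i j] i by (simp add: coords_def k_def field_simps)
  next
    show "?P \<in> forms n 1" "scale k ?A \<in> forms n 1"
      by (fact P, rule cpoly.subspace_scale[OF subspace_forms A(1)])
  qed
  moreover have "k \<noteq> 0"
    using calculation P(2) by auto
  ultimately show False
    using P(3) A(3) assms(3) by (metis proj_class_scale)
qed

section \<open>Independent conditions\<close>

definition coordinate :: "nat \<Rightarrow> cpoly" where
  "coordinate i = Poly_Mapping.single (Poly_Mapping.single i 1) 1"

lemma coordinate_in_forms: "i \<le> n \<Longrightarrow> coordinate i \<in> forms n 1"
  by (auto simp: coordinate_def forms_def monom_degree_def)

lemma eval_coordinate: "eval_form (coordinate i) a = a i"
  by (simp add: coordinate_def eval_form_single monom_eval_def)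

lemma coords_beyond:
  assumes "l \<in> forms n 1" "\<not> i \<le> n"
  shows "coords l i = 0"
proof (rule ccontr)
  assume "coords l i \<noteq> 0"
  then have "Poly_Mapping.single i 1 \<in> Poly_Mapping.keys l"
    by (simp add: coords_def in_keys_iff)
  then show False
    using assms by (force simp: forms_def)
qed

text \<open>Testing a relation in degree \<open>t + 1\<close> on \<open>z\<^sub>i h\<close> gives a relation in degree \<open>t\<close> whose coefficients
  are multiplied by the \<open>i\<close>-th coordinates.\<close>

lemma sum_coords_mult_eval_eq_0:
  assumes "S \<subseteq> proj_space n"
    and "\<forall>h\<in>forms n (Suc t). (\<Sum>p\<in>S. c p * eval_form h (coords (representative p))) = 0"
    and "h \<in> forms n t"
  shows "(\<Sum>p\<in>S. (c p * coords (representative p) i) * eval_form h (coords (representative p))) = 0"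
proof (cases "i \<le> n")
  case True
  then have "coordinate i * h \<in> forms n (Suc t)"
    using forms_mult[OF coordinate_in_forms assms(3)] by simp
  then show ?thesis
    using assms(2) by (auto simp: eval_form_mult eval_coordinate mult.assoc)
next
  case False
  then have "coords (representative p) i = 0" if "p \<in> S" for p
    using that assms(1) representative_props(1) by (blast intro: coords_beyond)
  then show ?thesis
    by simp
qed

text \<open>Given a relation on \<open>insert a S\<close> in degree \<open>t + 1\<close>, test it on products of a form of degree \<open>t\<close> with
  a linear form vanishing at \<open>a\<close> but not at \<open>p\<close>: the point \<open>a\<close> drops out and independence of \<open>S\<close> in
  degree \<open>t\<close> makes the coefficient of \<open>p\<close> zero. Only the term of \<open>a\<close> is then left.\<close>

lemma independent_conditions_Suc_insert:
  assumes S: "S \<subseteq> proj_space n" and a: "a \<in> proj_space n" "a \<notin> S" and "finite S"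
    and indep: "independent_conditions n t S"
  shows "independent_conditions n (Suc t) (insert a S)"
  unfolding independent_conditions_def
proof (intro allI impI)
  fix c
  let ?x = "\<lambda>p. coords (representative p)"
  assume c: "\<forall>f\<in>forms n (Suc t). (\<Sum>p\<in>insert a S. c p * eval_form f (?x p)) = 0"
  have aS: "insert a S \<subseteq> proj_space n"
    using S a by simp
  have S_zero: "c p = 0" if p: "p \<in> S" for p
  proof -
    obtain i j where ij: "?x a i * ?x p j \<noteq> ?x a j * ?x p i"
      using distinct_points_separated[of p n a] p S a by blast
    have "\<forall>p\<in>S. c p * (?x a i * ?x p j - ?x a j * ?x p i) = 0"
    proof (rule indep[unfolded independent_conditions_def, THEN spec, THEN mp], rule ballI)
      fix h assume h: "h \<in> forms n t"
      let ?s = "\<lambda>k. \<Sum>p\<in>insert a S. (c p * ?x p k) * eval_form h (?x p)"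
      have "(\<Sum>p\<in>insert a S. c p * (?x a i * ?x p j - ?x a j * ?x p i) * eval_form h (?x p)) =
          ?x a i * ?s j - ?x a j * ?s i"
        unfolding sum_distrib_left sum_subtractf[symmetric]
        by (intro sum.cong refl) (simp add: algebra_simps)
      also have "\<dots> = 0"
        using sum_coords_mult_eval_eq_0[OF aS c h] by simp
      finally show "(\<Sum>p\<in>S. c p * (?x a i * ?x p j - ?x a j * ?x p i) * eval_form h (?x p)) = 0"
        using a \<open>finite S\<close> by simp
    qed
    then show ?thesis
      using p ij by auto
  qed
  have "representative a \<in> forms n 1" "representative a \<noteq> 0"
    using representative_props a by auto
  then obtain i where i: "?x a i \<noteq> 0"
    using linear_form_eq_sum[of "representative a" n "{0..n}"] by fastforce
  \<comment> \<open>The power \<open>z\<^sub>i\<^bsup>t+1\<^esup>\<close> is a form that does not vanish at \<open>a\<close>.\<close>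
  have "i \<le> n"
    using i coords_beyond representative_props(1)[OF a(1)] by blast
  then have "c a * ?x a i ^ Suc t = 0"
    using c[rule_format, OF forms_power[OF coordinate_in_forms]] S_zero a \<open>finite S\<close>
    by (simp add: eval_form_power eval_coordinate del: power_Suc)
  then have "c a = 0"
    using i by simp
  then show "\<forall>p\<in>insert a S. c p = 0"
    using S_zero by simp
qed

lemma independent_conditions_Suc:
  assumes S: "S \<subseteq> proj_space n" and "independent_conditions n t S"
  shows "independent_conditions n (Suc t) S"
  unfolding independent_conditions_def
proof (intro allI impI ballI)
  fix c p
  let ?x = "\<lambda>p. coords (representative p)"
  assume c: "\<forall>f\<in>forms n (Suc t). (\<Sum>p\<in>S. c p * eval_form f (?x p)) = 0" and "p \<in> S"
  have "c p * ?x p i = 0" for i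
    using assms(2)[unfolded independent_conditions_def, rule_format, of "\<lambda>p. c p * ?x p i" p]
      sum_coords_mult_eval_eq_0[OF S c] \<open>p \<in> S\<close> by blast
  moreover have "representative p \<in> forms n 1" "representative p \<noteq> 0"
    using representative_props[of p n] S \<open>p \<in> S\<close> by auto
  ultimately show "c p = 0"
    using linear_form_eq_sum[of "representative p" n "{0..n}"] by fastforce
qed

lemma independent_conditions_mono:
  assumes "S \<subseteq> proj_space n" "independent_conditions n t S" "t \<le> t'"
  shows "independent_conditions n t' S"
  using assms(3)
proof (induction rule: dec_induct)
  case base
  show ?case
    by (fact assms(2))
next
  case (step t')
  then show ?case
    using independent_conditions_Suc[OF assms(1)] by blast
qed

lemma powers_independent:
  assumes "finite S" "S \<subseteq> proj_space n" "independent_conditions n e S"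
  shows "inj_on (\<lambda>p. representative p ^ e) S"
    and "cpoly.independent ((\<lambda>p. representative p ^ e) ` S)"
proof -
  let ?v = "\<lambda>p. representative p ^ e"
  have forms: "representative ` (S \<union> {}) \<subseteq> forms n 1"
    by (rule representatives_in_forms) (simp add: assms(2)[simplified])
  have zero: "c p = 0" if "(\<Sum>p\<in>S. scale (c p) (?v p)) = 0" "p \<in> S" for c p
    using power_relation_iff_evaluation_relation[OF forms, of c e]
      that assms(3) by (simp add: independent_conditions_def)
  show inj: "inj_on ?v S"
  proof (rule inj_onI, rule ccontr)
    fix p p' assume p: "p \<in> S" "p' \<in> S" "?v p = ?v p'" "p \<noteq> p'"
    let ?c = "(\<lambda>_. 0)(p := 1, p' := -1)"
    have "(\<Sum>s\<in>S. scale (?c s) (?v s)) = (\<Sum>s\<in>{p, p'}. scale (?c s) (?v s))"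
      using p assms(1) by (intro sum.mono_neutral_right) auto
    also have "\<dots> = 0"
      using p by simp
    finally show False
      using zero[of ?c p] p by simp
  qed
  show "cpoly.independent (?v ` S)"
  proof (rule cpoly.independent_if_scalars_zero)
    fix u x assume "(\<Sum>x\<in>?v ` S. scale (u x) x) = 0" "x \<in> ?v ` S"
    then show "u x = 0"
      using zero[of "\<lambda>p. u (?v p)"] by (auto simp: sum.reindex[OF inj])
  qed (use assms in simp)
qed

section \<open>Comparing two decompositions\<close>

text \<open>Contracting with the form dual to \<open>p\<close> leaves only the term of \<open>p\<close> on the side of \<open>S\<close>, while the
  side of \<open>A\<close> stays in the span whatever the values of that form on \<open>A\<close> are.\<close>

lemma powers_in_span_of_other_decomposition:
  assumes "finite S" "S \<subseteq> proj_space n" "finite A" "A \<subseteq> proj_space n"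
    and eq: "(\<Sum>p\<in>S. scale (c p) (representative p ^ d)) =
      (\<Sum>p\<in>A. scale (b p) (representative p ^ d))"
    and c: "\<And>p. p \<in> S \<Longrightarrow> c p \<noteq> 0"
    and indep: "independent_conditions n t S" and "t \<le> d"
  shows "(\<lambda>p. representative p ^ (d - t)) ` S \<subseteq>
    cpoly.span ((\<lambda>p. representative p ^ (d - t)) ` A)"
proof safe
  fix p assume p: "p \<in> S"
  let ?v = "\<lambda>p. representative p ^ (d - t)"
  let ?ev = "\<lambda>g p. eval_form g (coords (representative p))"
  obtain g where g: "g \<in> forms n t" "\<And>p'. p' \<in> S \<Longrightarrow> ?ev g p' = of_bool (p' = p)"
    using interpolation[OF assms(1), of n t "\<lambda>p. coords (representative p)"] indep p
    unfolding independent_conditions_def by blast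
  have "representative ` (S \<union> A) \<subseteq> forms n 1"
    by (rule representatives_in_forms[OF Un_least[OF assms(2,4)]])
  from contraction[OF this eq g(1) \<open>t \<le> d\<close>]
  have "(\<Sum>p'\<in>S. scale (c p' * ?ev g p') (?v p')) \<in> cpoly.span (?v ` A)"
    by (auto intro!: cpoly.span_sum cpoly.span_scale intro: cpoly.span_base)
  moreover have "(\<Sum>p'\<in>S. scale (c p' * ?ev g p') (?v p')) = scale (c p) (?v p)"
  proof -
    have "(\<Sum>p'\<in>S. scale (c p' * ?ev g p') (?v p')) =
        (\<Sum>p'\<in>S. if p' = p then scale (c p) (?v p) else 0)"
      using g by (intro sum.cong) auto
    then show ?thesis
      using p assms(1) by simp
  qed
  ultimately have "scale (1 / c p) (scale (c p) (?v p)) \<in> cpoly.span (?v ` A)"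
    by (metis cpoly.span_scale)
  then show "?v p \<in> cpoly.span (?v ` A)"
    using c[OF p] by (simp add: scale_scale)
qed

text \<open>The bound \<open>2 * t \<le> d\<close> says \<open>t \<le> d - t\<close>: independence in degree \<open>t\<close>, which isolates the powers of
  degree \<open>d - t\<close>, then also makes them linearly independent.\<close>

lemma decomposition_card_le:
  assumes "finite S" "S \<subseteq> proj_space n" "finite A" "A \<subseteq> proj_space n"
    and "(\<Sum>p\<in>S. scale (c p) (representative p ^ d)) =
      (\<Sum>p\<in>A. scale (b p) (representative p ^ d))"
    and "\<And>p. p \<in> S \<Longrightarrow> c p \<noteq> 0"
    and "independent_conditions n t S" and "2 * t \<le> d"
  shows "card S \<le> card A"
proof -
  let ?v = "\<lambda>p. representative p ^ (d - t)"
  have "independent_conditions n (d - t) S"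
    using assms by (intro independent_conditions_mono[of S n t "d - t"]) auto
  note v = powers_independent[OF assms(1,2) this]
  have "?v ` S \<subseteq> cpoly.span (?v ` A)"
    using assms by (intro powers_in_span_of_other_decomposition) auto
  then have "card (?v ` S) \<le> card (?v ` A)"
    using cpoly.independent_span_bound[of "?v ` A" "?v ` S"] v(2) assms(3) by simp
  also have "\<dots> \<le> card A"
    using assms(3) by (rule card_image_le)
  finally show ?thesis
    using card_image[OF v(1)] by simp
qed

text \<open>The strict inequality \<open>2 * t < d\<close> leaves one degree to spare: independence of \<open>S\<close> holds in degree
  \<open>d - t - 1\<close>, so a point outside \<open>S\<close> would give a new direction in degree \<open>d - t\<close>, whereas
  \<open>card A = card S\<close> forces the powers from \<open>A\<close> to lie in the span of those from \<open>S\<close>.\<close>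

lemma decomposition_unique:
  assumes "finite S" "S \<subseteq> proj_space n" "finite A" "A \<subseteq> proj_space n"
    and "(\<Sum>p\<in>S. scale (c p) (representative p ^ d)) =
      (\<Sum>p\<in>A. scale (b p) (representative p ^ d))"
    and "\<And>p. p \<in> S \<Longrightarrow> c p \<noteq> 0"
    and "independent_conditions n t S" and "2 * t < d" and card: "card A = card S"
  shows "A = S"
proof -
  let ?v = "\<lambda>p. representative p ^ (d - t)"
  have pred: "independent_conditions n (d - t - 1) S"
    using assms by (intro independent_conditions_mono[of S n t "d - t - 1"]) auto
  have Suc: "Suc (d - t - 1) = d - t"
    using assms(8) by simp
  have "independent_conditions n (d - t) S"
    using independent_conditions_Suc[OF assms(2) pred] unfolding Suc .
  note v = powers_independent[OF assms(1,2) this]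
  have sub: "?v ` S \<subseteq> cpoly.span (?v ` A)"
    using assms by (intro powers_in_span_of_other_decomposition) auto
  \<comment> \<open>A power from \<open>A\<close> outside this span would give \<open>card S + 1\<close> independent vectors in the span of
    \<open>card A = card S\<close> many.\<close>
  have span: "?v ` A \<subseteq> cpoly.span (?v ` S)"
  proof (rule ccontr)
    assume "\<not> ?thesis"
    then obtain x where x: "x \<in> ?v ` A" "x \<notin> cpoly.span (?v ` S)"
      by blast
    have "cpoly.independent (insert x (?v ` S))"
      using x v(2) by (simp add: cpoly.independent_insert)
    moreover have "insert x (?v ` S) \<subseteq> cpoly.span (?v ` A)"
      using x sub by (auto intro: cpoly.span_base)
    ultimately have "card (insert x (?v ` S)) \<le> card (?v ` A)"
      using cpoly.independent_span_bound[of "?v ` A"] assms(3) by blast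
    moreover have "x \<notin> ?v ` S"
      using x(2) cpoly.span_base[of x "?v ` S"] by blast
    ultimately have "Suc (card (?v ` S)) \<le> card (?v ` A)"
      using assms(1) by simp
    then show False
      using card card_image[OF v(1)] card_image_le[OF assms(3), of ?v] by linarith
  qed
  have "A \<subseteq> S"
  proof (rule ccontr)
    assume "\<not> A \<subseteq> S"
    then obtain a where a: "a \<in> A" "a \<notin> S"
      by blast
    then have aP: "a \<in> proj_space n"
      using assms(4) by blast
    have "independent_conditions n (d - t) (insert a S)"
      using independent_conditions_Suc_insert[OF assms(2) aP a(2) assms(1) pred] unfolding Suc .
    then have ins: "inj_on ?v (insert a S)" "cpoly.independent (?v ` insert a S)"
      using powers_independent[of "insert a S" n "d - t"] assms aP by auto
    then have "?v a \<notin> ?v ` S"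
      using a by (auto simp: inj_on_def)
    then have "?v a \<notin> cpoly.span (?v ` S)"
      using ins(2) by (auto simp: cpoly.independent_insert)
    then show False
      using span a by blast
  qed
  then show ?thesis
    using card assms(1) by (simp add: card_subset_eq)
qed

section \<open>Rank and uniqueness\<close>

theorem theorem1p1:
  fixes n d :: nat and q :: "cpoly set" and S :: "cpoly set set"
  assumes "n \<ge> 1" and "d \<ge> 1"
    and "q \<in> Proj (forms n d)"
    and "finite S" and "S \<subseteq> proj_space n"
    and "minimally_spans d S q"
  shows
    "(card S \<le> (n + d div 2) choose n \<and> independent_conditions n (d div 2) S
        \<longrightarrow> veronese_rank n d q = card S)
     \<and> (card S \<le> (n + d div 2 - 1) choose n \<and> independent_conditions n (d div 2 - 1) S
        \<longrightarrow> evinces_rank n d S q \<and> (\<forall>A. evinces_rank n d A q \<longrightarrow> A = S))"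
proof -
  obtain f where q: "q = proj_class f"
    using assms(3) by (auto simp: Proj_def)
  have q_S: "q \<in> proj_span (veronese d ` S)"
    using assms(6) by (simp add: minimally_spans_def)
  obtain c where c: "f \<noteq> 0" "f = (\<Sum>p\<in>S. scale (c p) (representative p ^ d))"
    using q_S in_proj_span_veronese_iff[OF assms(4,5)] by (auto simp: q)
  \<comment> \<open>A point with coefficient zero could be removed from \<open>S\<close>, against minimality.\<close>
  have c_nz: "c p \<noteq> 0" if "p \<in> S" for p
  proof
    assume "c p = 0"
    then have "f = (\<Sum>p'\<in>S - {p}. scale (c p') (representative p' ^ d))"
      using c(2) assms(4) that by (simp add: sum.remove)
    then have "q \<in> proj_span (veronese d ` (S - {p}))"
      using c(1) assms(4,5) in_proj_span_veronese_iff[of "S - {p}" n f d] by (auto simp: q)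
    then show False
      using assms(6) that by (auto simp: minimally_spans_def)
  qed
  have decomposition: "\<exists>b. (\<Sum>p\<in>S. scale (c p) (representative p ^ d)) =
      (\<Sum>p\<in>A. scale (b p) (representative p ^ d))"
    if "finite A" "A \<subseteq> proj_space n" "q \<in> proj_span (veronese d ` A)" for A
    using that in_proj_span_veronese_iff[of A n f d] c(2) by (auto simp: q)
  have rank: "veronese_rank n d q = card S" if "independent_conditions n t S" "2 * t \<le> d" for t
    unfolding veronese_rank_def
  proof (rule Least_equality)
    show "\<exists>A. finite A \<and> A \<subseteq> proj_space n \<and> q \<in> proj_span (veronese d ` A) \<and> card A = card S"
      using assms(4,5) q_S by blast
  next
    fix k
    assume "\<exists>A. finite A \<and> A \<subseteq> proj_space n \<and> q \<in> proj_span (veronese d ` A) \<and> card A = k"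
    then obtain A where A: "finite A" "A \<subseteq> proj_space n" "q \<in> proj_span (veronese d ` A)"
      "card A = k"
      by blast
    then obtain b where "(\<Sum>p\<in>S. scale (c p) (representative p ^ d)) =
        (\<Sum>p\<in>A. scale (b p) (representative p ^ d))"
      using decomposition by blast
    then have "card S \<le> card A"
      by (rule decomposition_card_le[OF assms(4,5) A(1,2) _ c_nz that])
    then show "card S \<le> k"
      by (simp only: A(4))
  qed
  have unique: "evinces_rank n d S q \<and> (\<forall>A. evinces_rank n d A q \<longrightarrow> A = S)"
    if t: "independent_conditions n t S" "2 * t < d" for t
  proof -
    have r: "veronese_rank n d q = card S"
      using rank t by simp
    have "A = S" if A: "evinces_rank n d A q" for A
    proof -
      have A': "finite A" "A \<subseteq> proj_space n" "q \<in> proj_span (veronese d ` A)" "card A = card S"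
        using A by (auto simp: evinces_rank_def r)
      obtain b where "(\<Sum>p\<in>S. scale (c p) (representative p ^ d)) =
          (\<Sum>p\<in>A. scale (b p) (representative p ^ d))"
        using decomposition A' by blast
      then show ?thesis
        by (rule decomposition_unique[OF assms(4,5) A'(1,2) _ c_nz t A'(4)])
    qed
    then show ?thesis
      using assms(4,5) q_S by (simp add: evinces_rank_def r)
  qed
  \<comment> \<open>For \<open>d = 1\<close> the truncated difference is degree \<open>0\<close>, which is still below \<open>d / 2\<close>.\<close>
  have "2 * (d div 2 - 1) < d"
    using assms(2) by linarith
  then show ?thesis
    using rank[of "d div 2"] unique[of "d div 2 - 1"] by auto
qed

end
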